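(* Let $(X_i,Y_i)$, $i=1,2,\ldots$, be i.i.d. random vectors from a continuous bivariate distribution with copula $C$, and let $\widehat\Phi_n$ be the empirical $W$-footrule estimator based on $(X_1,Y_1),\ldots,(X_n,Y_n)$. Then $$\widehat\Phi_n \xrightarrow{\ \mathrm{a.s.}\ } \Phi_C \quad\text{as } n\to\infty .$$
   Context: A (bivariate) copula $C$ is a distribution function on $[0,1]^2$ with uniform marginals. "Continuous bivariate distribution with copula $C$" means that the marginal distribution functions $F,G$ are continuous and the joint distribution function is $H(x,y)=C(F(x),G(y))$. Write $x^+=\max(x,0)$. $W$-footrule coefficient: $\Phi_C = 3\int_0^1\int_0^1 |1-u-v|\,\mathrm{d}C(u,v) - 1$, equivalently $\Phi_C = 6\int_0^1 C(u,1-u)\,\mathrm{d}u-1$. Estimator: let $R_i$ be the rank of $X_i$ among $X_1,\ldots,X_n$ and $S_i$ the rank of $Y_i$ among $Y_1,\ldots,Y_n$; put $\hat U_i=R_i/(n+1)$, $\hat V_i=S_i/(n+1)$, and $$\widehat\Phi_n=\frac{6}{n}\sum_{i=1}^n (1-\hat U_i-\hat V_i)^+-1=\frac{6}{n(n+1)}\sum_{i=1}^n (n+1-R_i-S_i)^+-1.$$ *)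

theory Defs
  imports "HOL-Probability.Probability"
begin

text \<open>
  A copula is a distribution function on the unit square with uniform marginals. \<open>copula_law C P\<close>
  says that \<open>P\<close> is the corresponding probability distribution, i.e. the measure \<open>dC\<close>. A copula is
  a total function here; its values outside the unit square are irrelevant.
\<close>

definition copula_law :: "(real \<Rightarrow> real \<Rightarrow> real) \<Rightarrow> (real \<times> real) measure \<Rightarrow> bool" where
  "copula_law C P \<longleftrightarrow>
     prob_space P \<and> sets P = sets borel \<and> measure P ({0..1} \<times> {0..1}) = 1 \<and>
     distr P borel fst = uniform_measure lborel {0..1} \<and>
     distr P borel snd = uniform_measure lborel {0..1} \<and>
     (\<forall>u\<in>{0..1}. \<forall>v\<in>{0..1}. C u v = measure P ({..u} \<times> {..v}))"

definition copula :: "(real \<Rightarrow> real \<Rightarrow> real) \<Rightarrow> bool" where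
  "copula C \<longleftrightarrow> (\<exists>P. copula_law C P)"

definition copula_measure :: "(real \<Rightarrow> real \<Rightarrow> real) \<Rightarrow> (real \<times> real) measure" where
  "copula_measure C = (THE P. copula_law C P)"

lemma copula_law_measure_eq:
  assumes "copula_law C P"
  shows "measure P ({..x} \<times> {..y}) =
    (if x < 0 \<or> y < 0 then 0 else C (min x 1) (min y 1))"
proof -
  interpret prob_space P using assms by (simp add: copula_law_def)
  have sets [simp, measurable_cong]: "sets P = sets (borel :: (real \<times> real) measure)"
    using assms by (simp add: copula_law_def)
  have box: "{a..b} \<times> {c..d} \<in> sets P" for a b c d :: real
    by (simp add: borel_closed closed_Times)
  have low: "{..a} \<times> {..b} \<in> sets P" for a b :: real
    by (simp add: borel_closed closed_Times)
  have conc: "AE p in P. p \<in> {0..1} \<times> {0..1}"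
    using assms box by (subst prob_eq_1[symmetric]) (auto simp: copula_law_def)
  show ?thesis
  proof (cases "x < 0 \<or> y < 0")
    case True
    have "AE p in P. p \<notin> {..x} \<times> {..y}"
      using conc by eventually_elim (use True in auto)
    then show ?thesis using True low by (subst (asm) prob_eq_0[symmetric]) auto
  next
    case False
    have "measure P ({..x} \<times> {..y}) = measure P ({..min x 1} \<times> {..min y 1})"
    proof (rule finite_measure_eq_AE)
      show "AE p in P. (p \<in> {..x} \<times> {..y}) = (p \<in> {..min x 1} \<times> {..min y 1})"
        using conc by eventually_elim auto
    qed (use low in auto)
    then show ?thesis using False assms by (simp add: copula_law_def)
  qed
qed

lemma copula_law_unique:
  assumes P: "copula_law C P" and Q: "copula_law C Q"
  shows "P = Q"
proof -
  interpret P: prob_space P using P by (simp add: copula_law_def)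
  interpret Q: prob_space Q using Q by (simp add: copula_law_def)
  let ?E = "range (\<lambda>a :: real \<times> real. {..a})"
  have atMost: "{..a} = {..fst a} \<times> {..snd a}" for a :: "real \<times> real"
    by (auto simp: less_eq_prod_def)
  have E: "sets (borel :: (real \<times> real) measure) = sigma_sets UNIV ?E"
    by (subst borel_eq_atMost) simp
  show ?thesis
  proof (rule measure_eqI_generator_eq)
    show "Int_stable ?E"
    proof (rule Int_stableI)
      fix A B assume "A \<in> ?E" "B \<in> ?E"
      then obtain a b where "A = {..a}" "B = {..b}" by auto
      then have "A \<inter> B = {..(min (fst a) (fst b), min (snd a) (snd b))}"
        by (auto simp: atMost)
      then show "A \<inter> B \<in> ?E" by blast
    qed
    show "emeasure P X = emeasure Q X" if "X \<in> ?E" for X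
      using that by (auto simp: atMost P.emeasure_eq_measure Q.emeasure_eq_measure
        copula_law_measure_eq[OF P] copula_law_measure_eq[OF Q])
    show "sets P = sigma_sets UNIV ?E" "sets Q = sigma_sets UNIV ?E"
      using P Q E by (auto simp: copula_law_def)
    show "range (\<lambda>n::nat. {..(real n, real n)}) \<subseteq> ?E" by auto
    show "(\<Union>n::nat. {..(real n, real n)}) = UNIV"
    proof -
      have "\<exists>n::nat. p \<in> {..(real n, real n)}" for p :: "real \<times> real"
      proof -
        obtain n :: nat where "max (fst p) (snd p) \<le> real n"
          using real_arch_simple by blast
        then show ?thesis by (auto simp: less_eq_prod_def)
      qed
      then show ?thesis by blast
    qed
  qed (auto simp: P.emeasure_eq_measure)
qed

lemma copula_law_copula_measure: "copula C \<Longrightarrow> copula_law C (copula_measure C)"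
  unfolding copula_def copula_measure_def
  by (rule theI') (blast intro: copula_law_unique)

definition W_footrule :: "(real \<Rightarrow> real \<Rightarrow> real) \<Rightarrow> real" where
  "W_footrule C = 3 * (\<integral>p. \<bar>1 - fst p - snd p\<bar> \<partial>copula_measure C) - 1"

definition continuous_with_copula ::
    "(real \<times> real) measure \<Rightarrow> (real \<Rightarrow> real \<Rightarrow> real) \<Rightarrow> bool" where
  "continuous_with_copula D C \<longleftrightarrow>
     prob_space D \<and> sets D = sets borel \<and>
     continuous_on UNIV (cdf (distr D borel fst)) \<and>
     continuous_on UNIV (cdf (distr D borel snd)) \<and>
     (\<forall>x y. measure D ({..x} \<times> {..y}) =
        C (cdf (distr D borel fst) x) (cdf (distr D borel snd) y))"

text \<open>
  The sample is indexed by \<open>1, \<dots>, n\<close>. With ties, \<open>sample_rank\<close> is the maximal rank; for samples from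
  continuous marginals ties have probability zero.
\<close>

definition sample_rank :: "nat \<Rightarrow> (nat \<Rightarrow> real) \<Rightarrow> nat \<Rightarrow> nat" where
  "sample_rank n x i = card {j \<in> {1..n}. x j \<le> x i}"

definition pseudo_obs :: "nat \<Rightarrow> (nat \<Rightarrow> real) \<Rightarrow> nat \<Rightarrow> real" where
  "pseudo_obs n x i = real (sample_rank n x i) / (real n + 1)"

definition W_footrule_est :: "nat \<Rightarrow> (nat \<Rightarrow> real) \<Rightarrow> (nat \<Rightarrow> real) \<Rightarrow> real" where
  "W_footrule_est n x y =
     6 / real n * (\<Sum>i=1..n. max (1 - pseudo_obs n x i - pseudo_obs n y i) 0) - 1"

lemma W_footrule_est_rank:
  "W_footrule_est n x y = 6 / (real n * (real n + 1)) *
     (\<Sum>i=1..n. max (real n + 1 - real (sample_rank n x i) - real (sample_rank n y i)) 0) - 1"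
proof -
  have "max (1 - pseudo_obs n x i - pseudo_obs n y i) 0 =
      max (real n + 1 - real (sample_rank n x i) - real (sample_rank n y i)) 0 / (real n + 1)" for i
  proof -
    have "1 - pseudo_obs n x i - pseudo_obs n y i =
        (real n + 1 - real (sample_rank n x i) - real (sample_rank n y i)) / (real n + 1)"
      by (simp add: pseudo_obs_def divide_simps)
    then show ?thesis by (simp add: max_divide_distrib_right)
  qed
  then show ?thesis
    by (simp add: W_footrule_est_def sum_divide_distrib[symmetric])
qed

end

theory Submission
  imports Defs
begin

text \<open>
  Let \<open>F\<close>, \<open>G\<close> be the marginal distribution functions. Since \<open>t \<mapsto> t\<^sup>+\<close> is 1-Lipschitz, replacing
  the pseudo-observations by \<open>F (X i)\<close> and \<open>G (Y i)\<close> changes the estimator by at most a constant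
  times the uniform distance between the empirical and the true marginal distribution functions,
  plus \<open>O(1/n)\<close>; this tends to 0 by Glivenko-Cantelli. The mean of the i.i.d. bounded variables
  \<open>(1 - F (X i) - G (Y i))\<^sup>+\<close> obeys the strong law (Hoeffding's inequality and Borel-Cantelli). By the
  probability integral transform \<open>(F (X i), G (Y i))\<close> has law \<open>dC\<close>, and \<open>\<bar>t\<bar> = 2 t\<^sup>+ - t\<close> together
  with \<open>E (1 - U - V) = 0\<close> identifies the limit as \<open>\<Phi>\<^sub>C\<close>.
\<close>

section \<open>Strong law of large numbers for bounded variables\<close>

text \<open>For each tolerance the deviation probabilities decay geometrically in \<open>n\<close>,
  hence are summable, and Borel-Cantelli leaves only finitely many deviations almost surely. The
  variables only have to share a mean and a bounding interval; identical distribution is not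
  assumed.\<close>

lemma (in prob_space) strong_law_bounded:
  fixes Z :: "nat \<Rightarrow> 'a \<Rightarrow> real"
  assumes indep: "indep_vars (\<lambda>_. borel) Z {1..}"
    and bounded: "\<And>i. i \<ge> 1 \<Longrightarrow> AE \<omega> in M. Z i \<omega> \<in> {a..b}"
    and expect: "\<And>i. i \<ge> 1 \<Longrightarrow> expectation (Z i) = m"
    and "a < b"
  shows "AE \<omega> in M. (\<lambda>n. (\<Sum>i=1..n. Z i \<omega>) / real n) \<longlonglongrightarrow> m"
proof -
  have rv [measurable]: "random_variable borel (Z i)" if "i \<in> {1..n}" for i n
    using indep that unfolding indep_vars_def by auto
  define A where
    "A e n = {\<omega> \<in> space M. \<bar>(\<Sum>i=1..n. Z i \<omega>) - real n * m\<bar> \<ge> real n * e}" for e and n :: nat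
  have A_sets [measurable]: "A e n \<in> sets M" for e n
    unfolding A_def by measurable
  have A_le: "measure M (A e n) \<le> 2 * exp (- 2 * e\<^sup>2 / (b - a)\<^sup>2) ^ n" if "n \<ge> 1" "e > 0" for e n
  proof -
    interpret H: Hoeffding_ineq M "{1..n}" Z "\<lambda>_. a" "\<lambda>_. b" "real n * m"
    proof unfold_locales
      show "indep_vars (\<lambda>_. borel) Z {1..n}"
        by (rule indep_vars_subset[OF indep]) auto
      show "real n * m \<equiv> \<Sum>i=1..n. expectation (Z i)"
        using expect by simp
    qed (use bounded in auto)
    have "measure M (A e n) \<le>
        2 * exp (- 2 * (real n * e)\<^sup>2 / (\<Sum>i\<in>{1..n}. (b - a)\<^sup>2))"
      unfolding A_def by (rule H.Hoeffding_ineq_abs_ge) (use that \<open>a < b\<close> in auto)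
    \<comment> \<open>The sum in the denominator equals \<open>n * (b - a)^2\<close>, so one factor
      \<open>n\<close> survives in the exponent and the bound becomes the \<open>n\<close>-th power
      of a fixed number.\<close>
    also have "- 2 * (real n * e)\<^sup>2 / (\<Sum>i\<in>{1..n}. (b - a)\<^sup>2) =
        real n * (- 2 * e\<^sup>2 / (b - a)\<^sup>2)"
      using that by (simp add: power2_eq_square)
    finally show ?thesis by (simp only: exp_of_nat_mult)
  qed
  have AE_A: "AE \<omega> in M. \<forall>\<^sub>F n in sequentially. \<omega> \<in> space M - A e n" if "e > 0" for e
  proof (rule borel_cantelli_AE1)
    have "- 2 * e\<^sup>2 / (b - a)\<^sup>2 < 0"
      using that \<open>a < b\<close> by (simp add: divide_neg_pos)
    then have "summable (\<lambda>n. 2 * exp (- 2 * e\<^sup>2 / (b - a)\<^sup>2) ^ n)"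
      by (intro summable_mult summable_geometric) auto
    then show "summable (\<lambda>n. measure M (A e n))"
      by (rule summable_comparison_test'[where N = 1]) (use A_le that in auto)
  qed (auto simp: emeasure_eq_measure)
  \<comment> \<open>The tolerances \<open>1 / (1 + k)\<close> are countable, so one null set serves
    all of them.\<close>
  have "AE \<omega> in M. \<forall>k::nat. \<forall>\<^sub>F n in sequentially. \<omega> \<in> space M - A (1 / (1 + real k)) n"
    by (subst AE_all_countable) (intro allI AE_A, simp)
  then show ?thesis
  proof eventually_elim
    case (elim \<omega>)
    show ?case
    proof (rule tendstoI)
      fix e :: real assume "e > 0"
      then obtain k :: nat where k: "1 / (1 + real k) < e"
        by (metis inverse_eq_divide of_nat_Suc reals_Archimedean)
      have "\<forall>\<^sub>F n in sequentially. \<omega> \<in> space M - A (1 / (1 + real k)) n"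
        using elim by blast
      then show "\<forall>\<^sub>F n in sequentially. dist ((\<Sum>i=1..n. Z i \<omega>) / real n) m < e"
        using eventually_gt_at_top[of 0]
      proof eventually_elim
        case (elim n)
        have "\<bar>(\<Sum>i=1..n. Z i \<omega>) - real n * m\<bar> < real n * (1 / (1 + real k))"
          using elim by (auto simp: A_def)
        also have "\<dots> < real n * e"
          using elim k by (intro mult_strict_left_mono) auto
        finally have "\<bar>(\<Sum>i=1..n. Z i \<omega>) - real n * m\<bar> / real n < e"
          using elim by (simp add: field_simps)
        also have "\<bar>(\<Sum>i=1..n. Z i \<omega>) - real n * m\<bar> / real n =
            \<bar>(\<Sum>i=1..n. Z i \<omega>) / real n - m\<bar>"
          using elim by (subst abs_div_pos) (auto simp: diff_divide_distrib)
        finally show ?case by (simp add: dist_real_def)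
      qed
    qed
  qed
qed

section \<open>Glivenko-Cantelli for continuous distribution functions\<close>

text \<open>Monotonicity traps \<open>E x\<close> between its values at neighbouring grid points,
  across which \<open>F\<close> grows by only \<open>1 / k\<close>; this is the price of passing
  from the grid to all \<open>x\<close>. Levels 0 and 1, which \<open>F\<close> may fail to attain,
  are replaced by the range bounds of \<open>E\<close> and \<open>F\<close>.\<close>

lemma mono_close_from_grid:
  fixes E F :: "real \<Rightarrow> real" and k :: nat
  assumes "mono E" "mono F"
    and E01: "\<And>x. E x \<in> {0..1}" and F01: "\<And>x. F x \<in> {0..1}"
    and "k > 0" "e \<ge> 0"
    and grid: "\<And>j. 0 < j \<Longrightarrow> j < k \<Longrightarrow> F (q j) = real j / real k"
    and close: "\<And>j. 0 < j \<Longrightarrow> j < k \<Longrightarrow> \<bar>E (q j) - F (q j)\<bar> \<le> e"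
  shows "\<bar>E x - F x\<bar> \<le> e + 1 / real k"
proof -
  have "E x \<le> F x + e + 1 / real k"
  proof -
    \<comment> \<open>The least integer strictly above \<open>k * F x\<close>: strictness forces
      \<open>x \<le> q j\<close>. If \<open>j \<ge> k\<close>, then already
      \<open>F x + 1 / k \<ge> 1 \<ge> E x\<close>.\<close>
    define j where "j = nat \<lfloor>real k * F x\<rfloor> + 1"
    have "real k * F x \<ge> 0" using F01[of x] by simp
    then have j: "real j - 1 \<le> real k * F x" "real k * F x < real j"
      unfolding j_def by linarith+
    then have j': "F x < real j / real k" "real j / real k \<le> F x + 1 / real k"
      using \<open>k > 0\<close> by (auto simp: field_simps)
    show ?thesis
    proof (cases "j < k")
      case True
      have "j > 0" by (simp add: j_def)
      have "x \<le> q j"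
        using j'(1) grid[OF \<open>j > 0\<close> True] monoD[OF \<open>mono F\<close>, of "q j" x] by linarith
      then show ?thesis
        using monoD[OF \<open>mono E\<close>, of x "q j"] j' grid[OF \<open>j > 0\<close> True] close[OF \<open>j > 0\<close> True]
        by linarith
    next
      case False
      then have "1 \<le> real j / real k" using \<open>k > 0\<close> by simp
      then show ?thesis using j' E01[of x] \<open>e \<ge> 0\<close> by auto
    qed
  qed
  moreover have "F x \<le> E x + e + 1 / real k"
  proof -
    \<comment> \<open>The greatest integer strictly below \<open>k * F x\<close>, so that
      \<open>q j \<le> x\<close>. For \<open>k * F x \<le> 1\<close> this gives
      \<open>j = 0\<close>, where there is no grid point; that case is settled by
      \<open>E x \<ge> 0\<close>.\<close>
    define j where "j = nat (\<lceil>real k * F x\<rceil> - 1)"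
    have le: "real k * F x \<le> real k" using F01[of x] \<open>k > 0\<close> by (simp add: mult_left_le)
    show ?thesis
    proof (cases "real k * F x \<le> 1")
      case True
      then have "F x \<le> 1 / real k" using \<open>k > 0\<close> by (simp add: field_simps)
      then show ?thesis using E01[of x] \<open>e \<ge> 0\<close> by auto
    next
      case False
      then have j: "j > 0" "real j < real k * F x" "real k * F x \<le> real j + 1"
        unfolding j_def by linarith+
      then have "j < k" using le by linarith
      have j': "real j / real k < F x" "F x \<le> real j / real k + 1 / real k"
        using j \<open>k > 0\<close> by (auto simp: field_simps)
      have "q j \<le> x"
        using j'(1) grid[OF \<open>j > 0\<close> \<open>j < k\<close>] monoD[OF \<open>mono F\<close>, of x "q j"] by linarith
      then show ?thesis
        using monoD[OF \<open>mono E\<close>, of "q j" x] j' grid[OF \<open>j > 0\<close> \<open>j < k\<close>] close[OF \<open>j > 0\<close> \<open>j < k\<close>]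
        by linarith
    qed
  qed
  ultimately show ?thesis by linarith
qed

text \<open>The limits 0 and 1 at the two infinities give points on either side of \<open>u\<close>,
  and the intermediate value theorem applies. The levels 0 and 1 are excluded since they are
  possibly only limits.\<close>

lemma (in real_distribution) continuous_cdf_attains:
  assumes "continuous_on UNIV (cdf M)" "0 < u" "u < 1"
  obtains x where "cdf M x = u"
proof -
  obtain a where a: "cdf M a < u"
    using order_tendstoD(2)[OF cdf_lim_at_bot \<open>0 < u\<close>]
    by (metis eventually_at_bot_linorder order_refl)
  obtain b where b: "u < cdf M b"
    using order_tendstoD(1)[OF cdf_lim_at_top_prob \<open>u < 1\<close>]
    by (metis eventually_at_top_linorder order_refl)
  have "a \<le> b" using a b cdf_nondecreasing[of b a] by linarith
  then have "\<exists>x\<ge>a. x \<le> b \<and> cdf M x = u"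
    using a b by (intro IVT') (auto intro: continuous_on_subset[OF assms(1)])
  then show ?thesis using that by blast
qed

text \<open>At a sample point \<open>z i\<close> this is \<open>sample_rank n z i / n\<close>, the
  link to \<open>pseudo_obs\<close>. For \<open>n = 0\<close> division by zero gives 0, so
  monotonicity and the bounds hold for every \<open>n\<close>.\<close>

definition ecdf :: "nat \<Rightarrow> (nat \<Rightarrow> real) \<Rightarrow> real \<Rightarrow> real" where
  "ecdf n z x = real (card {j \<in> {1..n}. z j \<le> x}) / real n"

text \<open>The form to which the strong law applies at a fixed \<open>x\<close>.\<close>

lemma ecdf_eq_mean: "ecdf n z x = (\<Sum>i=1..n. indicator {..x} (z i)) / real n"
proof -
  have "(\<Sum>i=1..n. indicator {..x} (z i)) = (\<Sum>i\<in>{1..n} \<inter> {i. z i \<le> x}. 1 :: real)"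
    unfolding sum.inter_restrict[OF finite_atLeastAtMost]
    by (intro sum.cong) (auto simp: indicator_def)
  also have "{1..n} \<inter> {i. z i \<le> x} = {j \<in> {1..n}. z j \<le> x}"
    by auto
  finally show ?thesis by (simp add: ecdf_def)
qed

lemma mono_ecdf: "mono (ecdf n z)"
proof (rule monoI)
  fix x y :: real assume "x \<le> y"
  then have "card {j \<in> {1..n}. z j \<le> x} \<le> card {j \<in> {1..n}. z j \<le> y}"
    by (intro card_mono) auto
  then show "ecdf n z x \<le> ecdf n z y"
    unfolding ecdf_def by (intro divide_right_mono) auto
qed

lemma ecdf_bounds: "ecdf n z x \<in> {0..1}"
proof -
  have "card {j \<in> {1..n}. z j \<le> x} \<le> card {1..n}" by (intro card_mono) auto
  then show ?thesis by (auto simp: ecdf_def divide_le_eq_1)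
qed

text \<open>The strong law gives convergence at each fixed point, with a null set depending on the
  point. Continuity supplies exact quantiles at all levels \<open>j / k\<close> with
  \<open>0 < j < k\<close>; these are countably many, and \<open>mono_close_from_grid\<close> makes
  the convergence on them uniform on the line.\<close>

lemma (in prob_space) glivenko_cantelli_continuous:
  fixes Z :: "nat \<Rightarrow> 'a \<Rightarrow> real"
  assumes indep: "indep_vars (\<lambda>_. borel) Z {1..}"
    and distr: "\<And>i. i \<ge> 1 \<Longrightarrow> distr M borel (Z i) = N"
    and cont: "continuous_on UNIV (cdf N)"
  shows "AE \<omega> in M. uniform_limit UNIV (\<lambda>n. ecdf n (\<lambda>i. Z i \<omega>)) (cdf N) sequentially"
proof -
  have rv [measurable]: "random_variable borel (Z i)" if "i \<ge> 1" for i
    using indep that unfolding indep_vars_def by auto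
  interpret N: real_distribution N
    using real_distribution_distr[OF rv[of 1]] distr[of 1] by (metis order_refl)
  define q where "q k j = (SOME x. cdf N x = real j / real k)" for k j :: nat
  have q: "cdf N (q k j) = real j / real k" if j: "0 < j" "j < k" for k j
  proof -
    have "\<exists>x. cdf N x = real j / real k"
      using N.continuous_cdf_attains[OF cont, of "real j / real k"] j by auto
    then show ?thesis unfolding q_def by (rule someI_ex)
  qed
  have pointwise: "AE \<omega> in M. (\<lambda>n. ecdf n (\<lambda>i. Z i \<omega>) x) \<longlonglongrightarrow> cdf N x" for x
    unfolding ecdf_eq_mean
  proof (rule strong_law_bounded[where a = 0 and b = 1])
    show "indep_vars (\<lambda>_. borel) (\<lambda>i \<omega>. indicator {..x} (Z i \<omega>) :: real) {1..}"
      by (rule indep_vars_compose2[OF indep]) auto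
    fix i :: nat assume i: "i \<ge> 1"
    have "expectation (\<lambda>\<omega>. indicator {..x} (Z i \<omega>) :: real) = integral\<^sup>L (distr M borel (Z i)) (indicator {..x})"
      using rv[OF i] by (subst integral_distr) auto
    then show "expectation (\<lambda>\<omega>. indicator {..x} (Z i \<omega>) :: real) = cdf N x"
      using distr[OF i] by (simp add: cdf_def)
  qed (auto simp: indicator_def)
  have "AE \<omega> in M. \<forall>k j. (\<lambda>n. ecdf n (\<lambda>i. Z i \<omega>) (q k j)) \<longlonglongrightarrow> cdf N (q k j)"
    by (subst AE_all_countable, intro allI, subst AE_all_countable) (auto intro: pointwise)
  then show ?thesis
  proof eventually_elim
    case (elim \<omega>)
    show ?case
    proof (rule uniform_limitI)
      fix e :: real assume "e > 0"
      then obtain k' :: nat where "inverse (real (Suc k')) < e / 2"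
        using reals_Archimedean[of "e / 2"] by auto
      then obtain k :: nat where k: "k > 0" "1 / real k < e / 2"
        by (metis inverse_eq_divide zero_less_Suc)
      \<comment> \<open>For fixed \<open>k\<close> the grid is finite, so one threshold for
        \<open>n\<close> works at all its points. The grid error \<open>e / 2\<close> and the mesh
        \<open>1 / k < e / 2\<close> add up to less than \<open>e\<close>.\<close>
      have "\<forall>\<^sub>F n in sequentially. \<forall>j\<in>{1..<k}. dist (ecdf n (\<lambda>i. Z i \<omega>) (q k j)) (cdf N (q k j)) < e / 2"
        using elim \<open>e > 0\<close> by (intro eventually_ball_finite ballI tendstoD) auto
      then show "\<forall>\<^sub>F n in sequentially. \<forall>x\<in>UNIV. dist (ecdf n (\<lambda>i. Z i \<omega>) x) (cdf N x) < e"
      proof eventually_elim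
        case (elim n)
        have "\<bar>ecdf n (\<lambda>i. Z i \<omega>) x - cdf N x\<bar> \<le> e / 2 + 1 / real k" for x
        proof (rule mono_close_from_grid[where E = "ecdf n (\<lambda>i. Z i \<omega>)" and F = "cdf N" and q = "q k"])
          show "\<bar>ecdf n (\<lambda>i. Z i \<omega>) (q k j) - cdf N (q k j)\<bar> \<le> e / 2" if "0 < j" "j < k" for j
            using bspec[OF elim, of j] that by (auto simp: dist_real_def)
          show "mono (cdf N)" by (intro monoI N.cdf_nondecreasing)
        qed (use k \<open>e > 0\<close> q ecdf_bounds mono_ecdf N.cdf_nonneg N.cdf_bounded_prob in auto)
        then show ?case using k(2) by (fastforce simp: dist_real_def intro: le_less_trans)
      qed
    qed
  qed
qed

section \<open>Probability integral transform\<close>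

text \<open>If \<open>cdf M x = u\<close>, then \<open>{..x}\<close> lies inside the set, which
  gives the lower bound. The converse inclusion fails where the cdf is flat to the right of
  \<open>x\<close>, so the upper bound comes from levels \<open>w > u\<close> and \<open>w\<close>
  tending to \<open>u\<close>.\<close>

lemma (in real_distribution) measure_cdf_le:
  assumes cont: "continuous_on UNIV (cdf M)" and u: "0 \<le> u" "u \<le> 1"
  shows "measure M {y. cdf M y \<le> u} = u"
proof (rule antisym)
  have [measurable]: "cdf M \<in> borel_measurable borel"
    using cont by (rule borel_measurable_continuous_onI)
  have sets: "{y. cdf M y \<le> u} \<in> sets M" by simp
  show "measure M {y. cdf M y \<le> u} \<le> u"
  proof (cases "u = 1")
    case False
    then have "u < 1" using u by simp
    then show ?thesis
    proof (rule dense_ge_bounded)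
      fix w assume w: "u < w" "w < 1"
      then obtain x where x: "cdf M x = w"
        using continuous_cdf_attains[OF cont, of w] u by auto
      have "{y. cdf M y \<le> u} \<subseteq> {..x}"
      proof
        fix y assume "y \<in> {y. cdf M y \<le> u}"
        then show "y \<in> {..x}" using x w cdf_nondecreasing[of x y] by force
      qed
      then have "measure M {y. cdf M y \<le> u} \<le> measure M {..x}"
        by (intro finite_measure_mono) auto
      then show "measure M {y. cdf M y \<le> u} \<le> w" using x by (simp add: cdf_def)
    qed
  qed simp
  show "u \<le> measure M {y. cdf M y \<le> u}"
  proof -
    consider "u = 0" | "0 < u" "u < 1" | "u = 1" using u by fastforce
    then show ?thesis
    proof cases
      case 2
      then obtain x where x: "cdf M x = u"
        using continuous_cdf_attains[OF cont] by blast
      have "measure M {..x} \<le> measure M {y. cdf M y \<le> u}"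
        using x sets by (intro finite_measure_mono) (auto intro: cdf_nondecreasing)
      then show ?thesis using x by (simp add: cdf_def)
    next
      case 3
      then have "{y. cdf M y \<le> u} = space M" using cdf_bounded_prob by auto
      then show ?thesis using 3 prob_space by simp
    qed simp
  qed
qed

text \<open>Only a flat stretch of the cdf to the right of \<open>x\<close> can violate the
  equivalence. It is null, because \<open>{y. cdf M y \<le> cdf M x}\<close> and its subset
  \<open>{..x}\<close> both have measure \<open>cdf M x\<close>.\<close>

lemma (in real_distribution) AE_cdf_le_iff:
  assumes cont: "continuous_on UNIV (cdf M)"
  shows "AE y in M. cdf M y \<le> cdf M x \<longleftrightarrow> y \<le> x"
proof -
  have [measurable]: "cdf M \<in> borel_measurable borel"
    using cont by (rule borel_measurable_continuous_onI)
  have "measure M ({y. cdf M y \<le> cdf M x} - {..x}) = measure M {y. cdf M y \<le> cdf M x} - measure M {..x}"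
    by (intro finite_measure_Diff) (auto intro: cdf_nondecreasing)
  also have "\<dots> = 0"
    using measure_cdf_le[OF cont cdf_nonneg cdf_bounded_prob, of x] by (simp add: cdf_def)
  finally have "AE y in M. y \<notin> {y. cdf M y \<le> cdf M x} - {..x}"
    by (subst (asm) prob_eq_0) auto
  then show ?thesis
    by eventually_elim (auto intro: cdf_nondecreasing)
qed

lemma uniform_measure_unit_interval:
  "uniform_measure lborel {0..1::real} =
    density lborel (\<lambda>x. ennreal (indicator {0..1} x / measure lborel {0..1::real}))"
  unfolding uniform_measure_def by (intro density_cong) (auto simp: indicator_def)

lemma (in real_distribution) distr_cdf_uniform:
  assumes cont: "continuous_on UNIV (cdf M)"
  shows "distr M borel (cdf M) = uniform_measure lborel {0..1}"
proof -
  have [measurable]: "cdf M \<in> borel_measurable borel"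
    using cont by (rule borel_measurable_continuous_onI)
  have "distributed M lborel (cdf M) (\<lambda>x. indicator {0..1} x / measure lborel {0..1::real})"
    using measure_cdf_le[OF cont] by (intro uniform_distrI_borel_atLeastAtMost) auto
  then have "distr M lborel (cdf M) = uniform_measure lborel {0..1}"
    unfolding distributed_def uniform_measure_unit_interval by simp
  moreover have "distr M borel (cdf M) = distr M lborel (cdf M)"
    by (intro distr_cong) auto
  ultimately show ?thesis by simp
qed

lemma prob_space_uniform_unit_interval: "prob_space (uniform_measure lborel {0..1::real})"
  by (intro prob_space_uniform_measure) auto

lemma measure_uniform_atMost:
  "u \<in> {0..1} \<Longrightarrow> measure (uniform_measure lborel {0..1::real}) {..u} = u"
  by (simp add: Int_atLeastAtMostR2 min_def)

lemma expectation_uniform: "(\<integral>x. x \<partial>uniform_measure lborel {0..1::real}) = 1 / 2"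
proof -
  interpret prob_space "uniform_measure lborel {0..1::real}"
    by (rule prob_space_uniform_unit_interval)
  have "distributed (uniform_measure lborel {0..1::real}) lborel (\<lambda>x. x)
      (\<lambda>x. indicator {0..1} x / measure lborel {0..1::real})"
    using measure_uniform_atMost
    by (intro uniform_distrI_borel_atLeastAtMost) (auto simp: atMost_def)
  then show ?thesis
    using uniform_distributed_expectation[of "\<lambda>x. x" 0 1] by simp
qed

section \<open>Laws on the plane with uniform marginals\<close>

lemma measurable_fst_borel [measurable]: "fst \<in> borel_measurable (borel :: (real \<times> real) measure)"
  and measurable_snd_borel [measurable]: "snd \<in> borel_measurable (borel :: (real \<times> real) measure)"
  by (intro borel_measurable_continuous_onI continuous_intros)+

lemma box_borel: "{..u} \<times> {..v} \<in> sets (borel :: (real \<times> real) measure)"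
  by (simp add: borel_closed closed_Times)

lemma half_plane_borel: "{p. fst p \<le> u} \<in> sets (borel :: (real \<times> real) measure)"
  "{p. snd p \<le> v} \<in> sets (borel :: (real \<times> real) measure)"
  by (intro borel_closed closed_Collect_le continuous_intros)+

text \<open>Covers both the measure \<open>dC\<close> and the law of the transformed pair, so that
  facts depending on the marginals alone are available for the latter before it is identified with
  \<open>dC\<close>.\<close>

locale uniform_marginals = prob_space P for P :: "(real \<times> real) measure" +
  assumes sets_P [simp, measurable_cong]: "sets P = sets borel"
    and distr_fst: "distr P borel fst = uniform_measure lborel {0..1}"
    and distr_snd: "distr P borel snd = uniform_measure lborel {0..1}"
begin

lemma space_P [simp]: "space P = UNIV"
  using sets_eq_imp_space_eq[OF sets_P] by simp

lemma AE_unit_square: "AE p in P. fst p \<in> {0..1} \<and> snd p \<in> {0..1}"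
proof -
  have U: "AE x in uniform_measure lborel {0..1::real}. x \<in> {0..1}"
    by (intro AE_uniform_measureI) auto
  have "AE p in P. fst p \<in> {0..1}"
    using U unfolding distr_fst[symmetric] by (subst (asm) AE_distr_iff) auto
  moreover have "AE p in P. snd p \<in> {0..1}"
    using U unfolding distr_snd[symmetric] by (subst (asm) AE_distr_iff) auto
  ultimately show ?thesis by eventually_elim simp
qed

lemma measure_fst_le: "u \<in> {0..1} \<Longrightarrow> measure P {p. fst p \<le> u} = u"
  using measure_distr[of fst P borel "{..u}"] measure_uniform_atMost[of u]
  unfolding distr_fst by (simp add: vimage_def)

lemma measure_snd_le: "v \<in> {0..1} \<Longrightarrow> measure P {p. snd p \<le> v} = v"
  using measure_distr[of snd P borel "{..v}"] measure_uniform_atMost[of v]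
  unfolding distr_snd by (simp add: vimage_def)

text \<open>A side of level 0 makes the box null; a side of level 1 is almost surely no restriction
  and leaves a uniform marginal. Thus all laws with uniform marginals agree on these boxes, which
  settles the levels that a continuous marginal cdf may not attain.\<close>

lemma measure_box_boundary:
  assumes uv: "u \<in> {0..1}" "v \<in> {0..1}" and "u \<in> {0, 1} \<or> v \<in> {0, 1}"
  shows "measure P ({..u} \<times> {..v}) = u * v"
proof -
  have le1: "measure P ({..u} \<times> {..v}) \<le> u"
  proof -
    have "{..u} \<times> {..v} \<subseteq> {p. fst p \<le> u}" by auto
    then have "measure P ({..u} \<times> {..v}) \<le> measure P {p. fst p \<le> u}"
      by (intro finite_measure_mono) (simp_all add: half_plane_borel)
    then show ?thesis using measure_fst_le[OF uv(1)] by simp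
  qed
  have le2: "measure P ({..u} \<times> {..v}) \<le> v"
  proof -
    have "{..u} \<times> {..v} \<subseteq> {p. snd p \<le> v}" by auto
    then have "measure P ({..u} \<times> {..v}) \<le> measure P {p. snd p \<le> v}"
      by (intro finite_measure_mono) (simp_all add: half_plane_borel)
    then show ?thesis using measure_snd_le[OF uv(2)] by simp
  qed
  have eq1: "measure P ({..u} \<times> {..v}) = v" if "u = 1"
  proof -
    have "measure P ({..u} \<times> {..v}) = measure P {p. snd p \<le> v}"
    proof (rule finite_measure_eq_AE)
      show "AE p in P. (p \<in> {..u} \<times> {..v}) = (p \<in> {p. snd p \<le> v})"
        using AE_unit_square by eventually_elim (use that in auto)
    qed (auto simp: box_borel half_plane_borel)
    then show ?thesis using measure_snd_le[OF uv(2)] by simp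
  qed
  have eq2: "measure P ({..u} \<times> {..v}) = u" if "v = 1"
  proof -
    have "measure P ({..u} \<times> {..v}) = measure P {p. fst p \<le> u}"
    proof (rule finite_measure_eq_AE)
      show "AE p in P. (p \<in> {..u} \<times> {..v}) = (p \<in> {p. fst p \<le> u})"
        using AE_unit_square by eventually_elim (use that in auto)
    qed (auto simp: box_borel half_plane_borel)
    then show ?thesis using measure_fst_le[OF uv(1)] by simp
  qed
  consider "u = 0" | "u = 1" | "v = 0" | "v = 1" using assms(3) by blast
  then show ?thesis
    by cases (use le1 le2 eq1 eq2 in \<open>simp_all add: measure_le_0_iff\<close>)
qed

lemma expectation_abs_antidiagonal:
  "(\<integral>p. \<bar>1 - fst p - snd p\<bar> \<partial>P) = 2 * (\<integral>p. max (1 - fst p - snd p) 0 \<partial>P)"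
proof -
  have int1: "integrable P fst"
    using AE_unit_square by (intro integrable_const_bound[where B = 1]) auto
  have int2: "integrable P snd"
    using AE_unit_square by (intro integrable_const_bound[where B = 1]) auto
  have "(\<integral>p. fst p \<partial>P) = (\<integral>x. x \<partial>distr P borel fst)"
    by (rule integral_distr[symmetric]) auto
  then have E1: "(\<integral>p. fst p \<partial>P) = 1 / 2"
    unfolding distr_fst expectation_uniform .
  have "(\<integral>p. snd p \<partial>P) = (\<integral>x. x \<partial>distr P borel snd)"
    by (rule integral_distr[symmetric]) auto
  then have E2: "(\<integral>p. snd p \<partial>P) = 1 / 2"
    unfolding distr_snd expectation_uniform .
  have int: "integrable P (\<lambda>p. 1 - fst p - snd p)" using int1 int2 by simp
  have "\<bar>t\<bar> = 2 * max t 0 - t" for t :: real by simp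
  then have "(\<integral>p. \<bar>1 - fst p - snd p\<bar> \<partial>P) =
      (\<integral>p. 2 * max (1 - fst p - snd p) 0 - (1 - fst p - snd p) \<partial>P)"
    by (simp only:)
  also have "\<dots> = 2 * (\<integral>p. max (1 - fst p - snd p) 0 \<partial>P) - (\<integral>p. 1 - fst p - snd p \<partial>P)"
    using int by (subst Bochner_Integration.integral_diff) auto
  also have "(\<integral>p. 1 - fst p - snd p \<partial>P) = 0"
    using int1 int2 E1 E2 prob_space by simp
  finally show ?thesis by simp
qed

end

lemma copula_law_uniform_marginals: "copula_law C P \<Longrightarrow> uniform_marginals P"
  unfolding copula_law_def uniform_marginals_def uniform_marginals_axioms_def by blast

text \<open>Rewrites the coefficient through the positive part, which is what the estimator
  averages; the factor 3 doubles to 6.\<close>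

lemma W_footrule_eq:
  assumes "copula C"
  shows "W_footrule C = 6 * (\<integral>p. max (1 - fst p - snd p) 0 \<partial>copula_measure C) - 1"
proof -
  interpret uniform_marginals "copula_measure C"
    by (rule copula_law_uniform_marginals[OF copula_law_copula_measure[OF assms]])
  show ?thesis by (simp add: W_footrule_def expectation_abs_antidiagonal)
qed

section \<open>Law of the pair transformed by its marginals\<close>

text \<open>The transformed law \<open>Q\<close> has uniform marginals by the integral transform. It
  remains to check its box values against \<open>C\<close>; uniqueness of the copula law then gives
  equality.\<close>

lemma distr_cdf_pair_eq_copula_measure:
  fixes D :: "(real \<times> real) measure"
  assumes "copula C" and D: "continuous_with_copula D C"
  defines "F \<equiv> cdf (distr D borel fst)" and "G \<equiv> cdf (distr D borel snd)"
  shows "distr D borel (\<lambda>p. (F (fst p), G (snd p))) = copula_measure C"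
proof -
  define P where "P = copula_measure C"
  have P: "copula_law C P"
    unfolding P_def by (rule copula_law_copula_measure[OF \<open>copula C\<close>])
  interpret P: uniform_marginals P
    by (rule copula_law_uniform_marginals[OF P])
  interpret D: prob_space D
    using D by (simp add: continuous_with_copula_def)
  have sets_D [simp, measurable_cong]: "sets D = sets borel"
    using D by (simp add: continuous_with_copula_def)
  have space_D [simp]: "space D = UNIV"
    using sets_eq_imp_space_eq[OF sets_D] by simp
  interpret D1: real_distribution "distr D borel fst" by (intro D.real_distribution_distr) simp
  interpret D2: real_distribution "distr D borel snd" by (intro D.real_distribution_distr) simp
  have F: "continuous_on UNIV F" and G: "continuous_on UNIV G"
    using D by (auto simp: continuous_with_copula_def F_def G_def)
  have [measurable]: "F \<in> borel_measurable borel" "G \<in> borel_measurable borel"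
    using F G by (auto intro: borel_measurable_continuous_onI)
  have T [measurable]: "(\<lambda>p. (F (fst p), G (snd p))) \<in> borel_measurable D"
    by measurable
  define Q where "Q = distr D borel (\<lambda>p. (F (fst p), G (snd p)))"
  interpret Q: uniform_marginals Q
  proof -
    interpret prob_space Q unfolding Q_def by (rule D.prob_space_distr[OF T])
    show "uniform_marginals Q"
    proof
      have "distr Q borel fst = distr (distr D borel fst) borel F"
        unfolding Q_def by (simp add: distr_distr o_def)
      then show "distr Q borel fst = uniform_measure lborel {0..1}"
        using D1.distr_cdf_uniform F unfolding F_def by simp
      have "distr Q borel snd = distr (distr D borel snd) borel G"
        unfolding Q_def by (simp add: distr_distr o_def)
      then show "distr Q borel snd = uniform_measure lborel {0..1}"
        using D2.distr_cdf_uniform G unfolding G_def by simp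
    qed (simp add: Q_def)
  qed
  have box: "C u v = measure Q ({..u} \<times> {..v})" if uv: "u \<in> {0..1}" "v \<in> {0..1}" for u v
  \<comment> \<open>On the boundary, points with \<open>F x = u\<close> and \<open>G y = v\<close>
    need not exist, so \<open>Q\<close> is compared with \<open>P\<close>, whose box values are
    those of \<open>C\<close>. In the interior such points exist, and up to a null set the event for
    \<open>Q\<close> is the quadrant \<open>{..x} \<times> {..y}\<close> under
    \<open>D\<close>.\<close>
  proof (cases "u \<in> {0, 1} \<or> v \<in> {0, 1}")
    case True
    then have "measure Q ({..u} \<times> {..v}) = measure P ({..u} \<times> {..v})"
      using P.measure_box_boundary[OF uv] Q.measure_box_boundary[OF uv] by simp
    then show ?thesis using P uv by (simp add: copula_law_def)
  next
    case False
    then have uv': "0 < u" "u < 1" "0 < v" "v < 1" using uv by auto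
    obtain x where x: "F x = u"
      using D1.continuous_cdf_attains[of u] F uv' unfolding F_def by blast
    obtain y where y: "G y = v"
      using D2.continuous_cdf_attains[of v] G uv' unfolding G_def by blast
    have AE1: "AE p in D. F (fst p) \<le> u \<longleftrightarrow> fst p \<le> x"
      using D1.AE_cdf_le_iff[of x] F x unfolding F_def[symmetric] by (subst (asm) AE_distr_iff) auto
    have AE2: "AE p in D. G (snd p) \<le> v \<longleftrightarrow> snd p \<le> y"
      using D2.AE_cdf_le_iff[of y] G y unfolding G_def[symmetric] by (subst (asm) AE_distr_iff) auto
    have "measure Q ({..u} \<times> {..v}) = measure D {p. F (fst p) \<le> u \<and> G (snd p) \<le> v}"
      unfolding Q_def by (subst measure_distr) (auto simp: box_borel vimage_def)
    also have "\<dots> = measure D ({..x} \<times> {..y})"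
    proof (rule D.finite_measure_eq_AE)
      show "AE p in D. (p \<in> {p. F (fst p) \<le> u \<and> G (snd p) \<le> v}) = (p \<in> {..x} \<times> {..y})"
        using AE1 AE2 by eventually_elim auto
    qed (auto simp: box_borel)
    also have "\<dots> = C u v"
      using D x y by (simp add: continuous_with_copula_def F_def G_def)
    finally show ?thesis by simp
  qed
  have "{0..1} \<times> {0..1} \<in> sets (borel :: (real \<times> real) measure)"
    by (simp add: borel_closed closed_Times)
  then have "measure Q ({0..1} \<times> {0..1}) = 1"
    using Q.AE_unit_square by (subst Q.prob_eq_1) (auto simp: mem_Times_iff)
  then have "copula_law C Q"
    unfolding copula_law_def
    using box Q.prob_space_axioms Q.sets_P Q.distr_fst Q.distr_snd by blast
  then show ?thesis
    using copula_law_unique[OF _ P] unfolding Q_def P_def by simp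
qed

section \<open>Deterministic comparison of the estimator with a sample mean\<close>

text \<open>Normalising the rank by \<open>n + 1\<close> instead of \<open>n\<close> multiplies the
  empirical cdf value \<open>c\<close> by \<open>n / (n + 1)\<close>, a change of
  \<open>c / (n + 1) \<le> 1 / n\<close>.\<close>

lemma pseudo_obs_close:
  assumes "n > 0" and "\<bar>ecdf n x (x i) - t\<bar> \<le> e"
  shows "\<bar>pseudo_obs n x i - t\<bar> \<le> e + 1 / real n"
proof -
  define c where "c = ecdf n x (x i)"
  have c: "0 \<le> c" "c \<le> 1" using ecdf_bounds[of n x "x i"] by (auto simp: c_def)
  have "pseudo_obs n x i = c * (real n / (real n + 1))"
    using assms(1) by (simp add: pseudo_obs_def sample_rank_def c_def ecdf_def)
  then have "c - pseudo_obs n x i = c / (real n + 1)"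
    by (simp add: field_simps)
  moreover have "c / (real n + 1) \<le> 1 / real n" "0 \<le> c / (real n + 1)"
    using c assms(1) by (auto intro: frac_le)
  ultimately show ?thesis using assms(2) unfolding c_def[symmetric] by linarith
qed

text \<open>Each summand contains two pseudo-observations, each off by at most
  \<open>e + 1 / n\<close>; averaging preserves the bound and the factor 6 produces the 12. This
  holds for every sample, with or without ties.\<close>

lemma W_footrule_est_close:
  assumes "n > 0"
    and F: "\<And>t. \<bar>ecdf n x t - F t\<bar> \<le> e" and G: "\<And>t. \<bar>ecdf n y t - G t\<bar> \<le> e"
  shows "\<bar>W_footrule_est n x y - (6 * ((\<Sum>i=1..n. max (1 - F (x i) - G (y i)) 0) / real n) - 1)\<bar>
    \<le> 12 * e + 12 / real n"
proof -
  let ?a = "\<lambda>i. max (1 - pseudo_obs n x i - pseudo_obs n y i) 0"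
  let ?b = "\<lambda>i. max (1 - F (x i) - G (y i)) 0"
  have le: "\<bar>?a i - ?b i\<bar> \<le> 2 * e + 2 / real n" for i
    using pseudo_obs_close[OF \<open>n > 0\<close> F[of "x i"]] pseudo_obs_close[OF \<open>n > 0\<close> G[of "y i"]]
    by linarith
  have "\<bar>(\<Sum>i=1..n. ?a i) - (\<Sum>i=1..n. ?b i)\<bar> \<le> (\<Sum>i=1..n. \<bar>?a i - ?b i\<bar>)"
    by (simp only: sum_subtractf[symmetric] sum_abs)
  also have "\<dots> \<le> real n * (2 * e + 2 / real n)"
    using sum_bounded_above[of "{1..n}" "\<lambda>i. \<bar>?a i - ?b i\<bar>", OF le] by simp
  finally have "\<bar>(\<Sum>i=1..n. ?a i) - (\<Sum>i=1..n. ?b i)\<bar> / real n \<le> 2 * e + 2 / real n"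
    using \<open>n > 0\<close> by (simp add: divide_le_eq mult.commute)
  then have "\<bar>(\<Sum>i=1..n. ?a i) / real n - (\<Sum>i=1..n. ?b i) / real n\<bar> \<le> 2 * e + 2 / real n"
    using \<open>n > 0\<close> by (simp add: diff_divide_distrib[symmetric])
  moreover have "W_footrule_est n x y = 6 * ((\<Sum>i=1..n. ?a i) / real n) - 1"
    by (simp add: W_footrule_est_def)
  ultimately show ?thesis by linarith
qed

theorem theorem1:
  fixes M :: "'a measure"
    and X Y :: "nat \<Rightarrow> 'a \<Rightarrow> real"
    and D :: "(real \<times> real) measure"
    and C :: "real \<Rightarrow> real \<Rightarrow> real"
  assumes "prob_space M"
    and "copula C"
    and "continuous_with_copula D C"
    and "prob_space.indep_vars M (\<lambda>_. borel) (\<lambda>i \<omega>. (X i \<omega>, Y i \<omega>)) {1..}"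
    and "\<And>i. i \<ge> 1 \<Longrightarrow> distr M borel (\<lambda>\<omega>. (X i \<omega>, Y i \<omega>)) = D"
  shows "AE \<omega> in M.
    (\<lambda>n. W_footrule_est n (\<lambda>i. X i \<omega>) (\<lambda>i. Y i \<omega>)) \<longlonglongrightarrow> W_footrule C"
proof -
  interpret prob_space M by fact
  note indep = assms(4) and distr_XY = assms(5)
  define F where "F = cdf (distr D borel fst)"
  define G where "G = cdf (distr D borel snd)"
  have cont: "continuous_on UNIV F" "continuous_on UNIV G"
    using assms(3) by (auto simp: continuous_with_copula_def F_def G_def)
  then have [measurable]: "F \<in> borel_measurable borel" "G \<in> borel_measurable borel"
    by (auto intro: borel_measurable_continuous_onI)
  have rv [measurable]: "random_variable borel (\<lambda>\<omega>. (X i \<omega>, Y i \<omega>))" if "i \<ge> 1" for i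
    using indep that unfolding indep_vars_def by auto
  have distr_X: "distr M borel (X i) = distr D borel fst" if "i \<ge> 1" for i
    using rv[OF that] unfolding distr_XY[OF that, symmetric]
    by (subst distr_distr) (auto simp: o_def)
  have distr_Y: "distr M borel (Y i) = distr D borel snd" if "i \<ge> 1" for i
    using rv[OF that] unfolding distr_XY[OF that, symmetric]
    by (subst distr_distr) (auto simp: o_def)
  \<comment> \<open>Independence across the pairs passes to each coordinate sequence, while
    \<open>X i\<close> and \<open>Y i\<close> may depend on each other.\<close>
  have indep_X: "indep_vars (\<lambda>_. borel) X {1..}" and indep_Y: "indep_vars (\<lambda>_. borel) Y {1..}"
    using indep_vars_compose2[OF indep, of "\<lambda>_. fst" "\<lambda>_. borel"]
      indep_vars_compose2[OF indep, of "\<lambda>_. snd" "\<lambda>_. borel"] by simp_all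
  have AE_X: "AE \<omega> in M. uniform_limit UNIV (\<lambda>n. ecdf n (\<lambda>i. X i \<omega>)) F sequentially"
    using cont unfolding F_def by (intro glivenko_cantelli_continuous indep_X distr_X)
  have AE_Y: "AE \<omega> in M. uniform_limit UNIV (\<lambda>n. ecdf n (\<lambda>i. Y i \<omega>)) G sequentially"
    using cont unfolding G_def by (intro glivenko_cantelli_continuous indep_Y distr_Y)
  \<comment> \<open>As a function of the whole pair, \<open>h\<close> inherits independence from the
    sample; \<open>FG\<close> places its values in \<open>[0,1]\<close>, as the strong law
    requires.\<close>
  define h :: "real \<times> real \<Rightarrow> real" where "h p = max (1 - F (fst p) - G (snd p)) 0" for p
  have h [measurable]: "h \<in> borel_measurable borel" unfolding h_def by measurable
  have FG: "F t \<in> {0..1}" "G t \<in> {0..1}" for t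
  proof -
    interpret D: prob_space D using assms(3) by (simp add: continuous_with_copula_def)
    have "sets D = sets borel" using assms(3) by (simp add: continuous_with_copula_def)
    note [measurable_cong] = this
    interpret D1: real_distribution "distr D borel fst" by (intro D.real_distribution_distr) simp
    interpret D2: real_distribution "distr D borel snd" by (intro D.real_distribution_distr) simp
    show "F t \<in> {0..1}" "G t \<in> {0..1}"
      by (auto simp: F_def G_def D1.cdf_nonneg D1.cdf_bounded_prob D2.cdf_nonneg D2.cdf_bounded_prob)
  qed
  have AE_h: "AE \<omega> in M. (\<lambda>n. (\<Sum>i=1..n. h (X i \<omega>, Y i \<omega>)) / real n) \<longlonglongrightarrow> (\<integral>p. h p \<partial>D)"
  proof (rule strong_law_bounded[where a = 0 and b = 1])
    show "indep_vars (\<lambda>_. borel) (\<lambda>i \<omega>. h (X i \<omega>, Y i \<omega>)) {1..}"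
      by (rule indep_vars_compose2[OF indep]) simp
    show "AE \<omega> in M. h (X i \<omega>, Y i \<omega>) \<in> {0..1}" for i
    proof (intro AE_I2)
      fix \<omega>
      show "h (X i \<omega>, Y i \<omega>) \<in> {0..1}"
        using FG(1)[of "X i \<omega>"] FG(2)[of "Y i \<omega>"] by (auto simp: h_def)
    qed
    show "expectation (\<lambda>\<omega>. h (X i \<omega>, Y i \<omega>)) = (\<integral>p. h p \<partial>D)" if "i \<ge> 1" for i
      using rv[OF that] unfolding distr_XY[OF that, symmetric] by (subst integral_distr) auto
  qed simp
  have W: "W_footrule C = 6 * (\<integral>p. h p \<partial>D) - 1"
  proof -
    have "(\<lambda>p. (F (fst p), G (snd p))) \<in> borel_measurable D"
      using assms(3) by (auto simp: continuous_with_copula_def cong: measurable_cong_sets)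
    then have "(\<integral>p. max (1 - fst p - snd p) 0 \<partial>copula_measure C) = (\<integral>p. h p \<partial>D)"
      unfolding distr_cdf_pair_eq_copula_measure[OF assms(2,3), folded F_def G_def, symmetric] h_def
      by (subst integral_distr) auto
    then show ?thesis using W_footrule_eq[OF assms(2)] by simp
  qed
  show ?thesis
    using AE_X AE_Y AE_h
  proof eventually_elim
    case (elim \<omega>)
    let ?x = "\<lambda>i. X i \<omega>" and ?y = "\<lambda>i. Y i \<omega>"
    \<comment> \<open>The estimator with the true marginals in place of the pseudo-observations. It
      converges by the strong law, so only the difference has to vanish.\<close>
    define A where "A n = 6 * ((\<Sum>i=1..n. h (?x i, ?y i)) / real n) - 1" for n :: nat
    have A: "A \<longlonglongrightarrow> W_footrule C"
      unfolding A_def W by (intro tendsto_intros elim(3))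
    have "(\<lambda>n. W_footrule_est n ?x ?y - A n) \<longlonglongrightarrow> 0"
    proof (rule tendstoI)
      fix e :: real assume "e > 0"
      \<comment> \<open>With \<open>e / 36\<close> the bound \<open>12 * (e / 36) + 12 / n\<close>
        is below \<open>e / 3 + e / 3\<close>, hence below \<open>e\<close>.\<close>
      have "\<forall>\<^sub>F n in sequentially. \<forall>t\<in>UNIV. dist (ecdf n ?x t) (F t) < e / 36"
        using elim(1) \<open>e > 0\<close> by (intro uniform_limitD) auto
      moreover have "\<forall>\<^sub>F n in sequentially. \<forall>t\<in>UNIV. dist (ecdf n ?y t) (G t) < e / 36"
        using elim(2) \<open>e > 0\<close> by (intro uniform_limitD) auto
      moreover have "(\<lambda>n. 12 / real n) \<longlonglongrightarrow> 0" by (rule lim_const_over_n)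
      then have "\<forall>\<^sub>F n in sequentially. 12 / real n < e / 3"
        using \<open>e > 0\<close> by (intro order_tendstoD(2)) auto
      ultimately show "\<forall>\<^sub>F n in sequentially. dist (W_footrule_est n ?x ?y - A n) 0 < e"
        using eventually_gt_at_top[of 0]
      proof eventually_elim
        case (elim n)
        then have "\<bar>W_footrule_est n ?x ?y - A n\<bar> \<le> 12 * (e / 36) + 12 / real n"
          unfolding A_def h_def fst_conv snd_conv
          by (intro W_footrule_est_close) (auto simp: dist_real_def less_imp_le)
        then show ?case using elim(3) \<open>e > 0\<close> by simp
      qed
    qed
    from tendsto_add[OF this A] show ?case by simp
  qed
qed

end
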